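(* Let $\mu\in(0,1)$ and let $X\sim\mathrm{Ber}(\mu)$ be a Bernoulli random variable. Then the function $h:\mathbb{R}\to\mathbb{R}$, $$h(\lambda)=\frac{2}{\lambda^2}\left(\ln(\mu e^\lambda+1-\mu)-\mu\lambda\right)\ (\lambda\ne0),\qquad h(0)=\mu(1-\mu),$$ admits a unique critical point, which is a global maximum. The global maximizer is $\lambda_0=2\ln\frac{1-\mu}{\mu}$, and the optimal proxy variance of $X$ is $$\sigma_{\mathrm{opt}}^2=h(\lambda_0)=\frac{\frac12-\mu}{\ln\left(\frac1\mu-1\right)},$$ where for $\mu=\frac12$ the right-hand side is understood as its limit $\frac14$.
   Context: A random variable $X$ with finite mean $m=\mathbb{E}[X]$ is $\sigma^2$-sub-Gaussian, with proxy variance $\sigma^2>0$, if $\mathbb{E}[\exp(\lambda(X-m))]\le \exp(\lambda^2\sigma^2/2)$ for all $\lambda\in\mathbb{R}$. The smallest such $\sigma^2$ is the optimal proxy variance $\sigma_{\mathrm{opt}}^2=\sigma_{\mathrm{opt}}^2(X)$. A critical point of $h$ is a point $\lambda\in\mathbb{R}$ with $h'(\lambda)=0$. $\mathrm{Ber}(\mu)$ is the distribution on $\{0,1\}$ with $\mathbb{P}[X=1]=\mu$. *)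

theory Defs
  imports "HOL-Probability.Probability"
begin

text \<open>
  Integrability is required explicitly because the Bochner integral of a non-integrable
  function is 0, whereas for a nonnegative random variable the bound on the expectation
  should entail that it is finite.
\<close>

definition sub_gaussian :: "'a measure \<Rightarrow> ('a \<Rightarrow> real) \<Rightarrow> real \<Rightarrow> bool" where
  "sub_gaussian M X v \<longleftrightarrow>
     v > 0 \<and> integrable M X \<and>
     (\<forall>l::real. integrable M (\<lambda>x. exp (l * (X x - (LINT y|M. X y)))) \<and>
        (LINT x|M. exp (l * (X x - (LINT y|M. X y)))) \<le> exp (l\<^sup>2 * v / 2))"

text \<open>
  A predicate rather than a function of \<open>X\<close>: it asserts in particular that a smallest
  proxy variance exists. The proxy variance \<open>v\<close> stands for \<open>\<sigma>\<^sup>2\<close>.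
\<close>

definition is_optimal_proxy_variance :: "'a measure \<Rightarrow> ('a \<Rightarrow> real) \<Rightarrow> real \<Rightarrow> bool" where
  "is_optimal_proxy_variance M X v \<longleftrightarrow>
     sub_gaussian M X v \<and> (\<forall>w. sub_gaussian M X w \<longrightarrow> v \<le> w)"

definition critical_point :: "(real \<Rightarrow> real) \<Rightarrow> real \<Rightarrow> bool" where
  "critical_point f l \<longleftrightarrow> (f has_real_derivative 0) (at l)"

text \<open>
  The library's Bernoulli distribution lives on \<open>bool\<close>; here it is transported to \<open>{0, 1}\<close>
  in the reals.
\<close>

definition bernoulli_rv :: "'a measure \<Rightarrow> ('a \<Rightarrow> real) \<Rightarrow> real \<Rightarrow> bool" where
  "bernoulli_rv M X \<mu> \<longleftrightarrow>
     X \<in> borel_measurable M \<and>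
     distr M borel X = distr (measure_pmf (bernoulli_pmf \<mu>)) borel (of_bool :: bool \<Rightarrow> real)"

definition bernoulli_h :: "real \<Rightarrow> real \<Rightarrow> real" where
  "bernoulli_h \<mu> l =
     (if l = 0 then \<mu> * (1 - \<mu>)
      else 2 / l\<^sup>2 * (ln (\<mu> * exp l + 1 - \<mu>) - \<mu> * l))"

end

theory Submission
  imports Defs
begin

text \<open>
  Write \<open>\<mu> = (1 - tanh b) / 2\<close>, so that \<open>b\<close> is half the log-odds of \<open>0\<close> against \<open>1\<close>. With
  \<open>u = l / 2 - b\<close> and \<open>v = - b\<close>, the centred cumulant generating function of the Bernoulli law
  becomes \<open>ln (cosh u) - ln (cosh v) - (u - v) * tanh v\<close>
  (\<open>bernoulli_log_mgf_conv_ln_cosh\<close>). Differentiating \<open>h\<close>, which is \<open>2 / l\<^sup>2\<close> times this function,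
  produces \<open>- 2 / l ^ 3\<close> times
  \<open>D = 2 * (ln (cosh u) - ln (cosh v)) - (u - v) * (tanh u + tanh v)\<close>,
  which is twice the error of the trapezoid rule for the integral of \<open>tanh\<close> from \<open>v\<close> to \<open>u\<close>.

  The sign of that error is decided by symmetry. As \<open>tanh\<close> is odd, \<open>D\<close> vanishes at
  \<open>u = \<bar>v\<bar>\<close>. For \<open>u > \<bar>v\<bar>\<close> its derivative in \<open>u\<close> compares the mean slope of \<open>tanh\<close> on
  \<open>[v, u]\<close> with the slope at \<open>u\<close>, where it is smallest because \<open>1 - tanh\<^sup>2\<close> decreases in the
  absolute value of its argument; so \<open>D > 0\<close> (\<open>trapezoid_defect_pos\<close>). The remaining positions
  of \<open>u\<close> and \<open>v\<close> follow by swapping and negating them: \<open>(u - v) * D\<close> has the sign of \<open>u + v\<close>,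
  which is \<open>l / 2 - 2 * b\<close>. Hence the derivative of \<open>h\<close> has the sign of \<open>4 * b - l\<close>; at the
  removable singularity \<open>l = 0\<close> this is read off from the limit of the difference quotient
  (\<open>bernoulli_h_deriv_sgn\<close>). So \<open>4 * b\<close>, which is \<open>l0\<close>, is the only critical point and the strict
  global maximum, with value \<open>tanh b / (4 * b)\<close> if \<open>b \<noteq> 0\<close>.

  Finally, the sub-Gaussian inequality at \<open>l \<noteq> 0\<close> says precisely \<open>h l \<le> \<sigma>\<^sup>2\<close>
  (\<open>sub_gaussian_bernoulli_iff\<close>), so the optimal proxy variance is the maximum of \<open>h\<close>.
\<close>

section \<open>The trapezoid rule for the hyperbolic tangent\<close>

lemma has_real_derivative_ln_cosh:
  "((\<lambda>x::real. ln (cosh x)) has_real_derivative tanh x) (at x)"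
  by (auto intro!: derivative_eq_intros simp: tanh_def)

lemma has_real_derivative_tanh:
  "(tanh has_real_derivative 1 - (tanh x)\<^sup>2) (at (x::real))"
  by (auto intro!: derivative_eq_intros)

text \<open>
  Twice the integral of \<open>tanh\<close> from \<open>v\<close> to \<open>u\<close>, minus twice its trapezoid approximation.
\<close>

definition trapezoid_defect :: "real \<Rightarrow> real \<Rightarrow> real" where
  "trapezoid_defect v u = 2 * (ln (cosh u) - ln (cosh v)) - (u - v) * (tanh u + tanh v)"

text \<open>
  As a function of \<open>u\<close> the defect starts from \<open>0\<close> at \<open>\<bar>v\<bar>\<close>: either \<open>u = v\<close>, or
  \<open>u = - v\<close> and both terms vanish by parity. It then increases, since on the interval from \<open>v\<close>
  to \<open>u\<close> the slope of \<open>tanh\<close> is smallest at the endpoint \<open>u\<close>. Starting at \<open>\<bar>v\<bar>\<close> rather than at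
  \<open>v\<close> covers negative \<open>v\<close>, where \<open>tanh\<close> is not concave on the whole interval.
\<close>

lemma trapezoid_defect_pos:
  assumes "\<bar>v\<bar> < u"
  shows "0 < trapezoid_defect v u"
proof -
  have deriv: "(trapezoid_defect v has_real_derivative
      (tanh x - tanh v) - (x - v) * (1 - (tanh x)\<^sup>2)) (at x)" for x
    unfolding trapezoid_defect_def
    by (auto intro!: derivative_eq_intros has_real_derivative_ln_cosh has_real_derivative_tanh
        simp: algebra_simps tanh_def[of x])
  have pos: "0 < (tanh x - tanh v) - (x - v) * (1 - (tanh x)\<^sup>2)" if x: "\<bar>v\<bar> < x" for x
  proof -
    have "v < x" using x by simp
    then obtain z where z: "v < z" "z < x"
      and eq: "tanh x - tanh v = (x - v) * (1 - (tanh z)\<^sup>2)"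
      using MVT2[of v x tanh "\<lambda>y. 1 - (tanh y)\<^sup>2"] has_real_derivative_tanh by blast
    have "\<bar>z\<bar> < x" using x z by linarith
    then have "\<bar>tanh z\<bar> < \<bar>tanh x\<bar>"
      by (smt (verit, best) tanh_real_abs tanh_real_less_iff)
    then have "(tanh z)\<^sup>2 < (tanh x)\<^sup>2" by (simp add: abs_le_square_iff flip: not_le)
    then show ?thesis using \<open>v < x\<close> unfolding eq by (simp add: mult_strict_left_mono)
  qed
  have "trapezoid_defect v \<bar>v\<bar> < trapezoid_defect v u"
  proof (rule DERIV_pos_imp_increasing_open[OF assms])
    show "\<exists>y. (trapezoid_defect v has_real_derivative y) (at x) \<and> 0 < y"
      if "\<bar>v\<bar> < x" "x < u" for x
      using deriv pos[OF that(1)] by blast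
    show "continuous_on {\<bar>v\<bar>..u} (trapezoid_defect v)"
      using deriv by (meson DERIV_isCont continuous_at_imp_continuous_on)
  qed
  moreover have "trapezoid_defect v \<bar>v\<bar> = 0"
    by (auto simp: trapezoid_defect_def abs_if)
  ultimately show ?thesis by simp
qed

text \<open>
  The expression \<open>(u - v) * trapezoid_defect v u\<close> is symmetric in \<open>u\<close> and \<open>v\<close> and odd under
  negating both of them, so whichever of \<open>u\<close> and \<open>v\<close> is larger in absolute value can be made the
  positive upper endpoint.
\<close>

lemma sgn_trapezoid_defect:
  assumes "u \<noteq> v"
  shows "sgn ((u - v) * trapezoid_defect v u) = sgn (u + v)"
proof -
  have swap: "trapezoid_defect u v = - trapezoid_defect v u"
    and reflect: "trapezoid_defect (- v) (- u) = trapezoid_defect v u"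
    and swap_reflect: "trapezoid_defect (- u) (- v) = - trapezoid_defect v u"
    by (simp_all add: trapezoid_defect_def algebra_simps)
  consider "u + v = 0" | "\<bar>v\<bar> < u" | "\<bar>u\<bar> < v" | "\<bar>v\<bar> < - u" | "\<bar>u\<bar> < - v"
    using assms by linarith
  then show ?thesis
  proof cases
    case 1
    then have "u = - v" by simp
    then show ?thesis by (simp add: trapezoid_defect_def)
  next
    case 2
    with trapezoid_defect_pos[OF this] show ?thesis by (simp add: sgn_mult)
  next
    case 3
    with trapezoid_defect_pos[OF this] show ?thesis by (simp add: sgn_mult swap)
  next
    case 4
    with trapezoid_defect_pos[of "- v" "- u"] show ?thesis by (simp add: sgn_mult reflect)
  next
    case 5
    with trapezoid_defect_pos[of "- u" "- v"] show ?thesis by (simp add: sgn_mult swap_reflect)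
  qed
qed

section \<open>The derivative of the Bernoulli function\<close>

text \<open>
  The parameters are \<open>\<mu> = exp (- b) / (2 * cosh b)\<close> and \<open>1 - \<mu> = exp b / (2 * cosh b)\<close>;
  taking \<open>exp (l / 2)\<close> out of the moment generating function leaves a hyperbolic cosine.
\<close>

lemma bernoulli_log_mgf_conv_ln_cosh:
  fixes b l :: real
  defines "\<mu> \<equiv> (1 - tanh b) / 2"
  shows "ln (\<mu> * exp l + 1 - \<mu>) - \<mu> * l
    = ln (cosh (l / 2 - b)) - ln (cosh b) + l / 2 * tanh b"
proof -
  have "\<mu> * exp l + 1 - \<mu> = exp (l / 2) * cosh (l / 2 - b) / cosh b"
  proof -
    have t: "tanh b * cosh b = sinh b" by (simp add: tanh_def)
    have "(\<mu> * exp l + 1 - \<mu>) * cosh b = (exp l * (cosh b - sinh b) + (cosh b + sinh b)) / 2"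
      by (simp add: \<mu>_def field_simps flip: t)
    also have "\<dots> = (exp l * exp (- b) + exp b) / 2"
      by (simp add: cosh_minus_sinh cosh_plus_sinh)
    also have "\<dots> = exp (l / 2) * cosh (l / 2 - b)"
      by (simp add: cosh_def field_simps flip: exp_add)
    finally show ?thesis by (simp add: field_simps)
  qed
  then have "ln (\<mu> * exp l + 1 - \<mu>) = l / 2 + ln (cosh (l / 2 - b)) - ln (cosh b)"
    by (simp add: ln_mult ln_div)
  moreover have "\<mu> * l = l / 2 - l / 2 * tanh b"
    by (simp add: \<mu>_def field_simps)
  ultimately show ?thesis by linarith
qed

lemma bernoulli_h_conv_ln_cosh:
  "bernoulli_h ((1 - tanh b) / 2) l =
    (if l = 0 then (1 - (tanh b)\<^sup>2) / 4
     else 2 / l\<^sup>2 * (ln (cosh (l / 2 - b)) - ln (cosh b) + l / 2 * tanh b))"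
  unfolding bernoulli_h_def bernoulli_log_mgf_conv_ln_cosh
  by (simp add: field_simps power2_eq_square)

lemma bernoulli_h_deriv_nonzero:
  assumes "l \<noteq> 0"
  shows "(bernoulli_h ((1 - tanh b) / 2) has_real_derivative
    - 2 * trapezoid_defect (- b) (l / 2 - b) / l ^ 3) (at l)"
proof -
  let ?F = "\<lambda>l. 2 / l\<^sup>2 * (ln (cosh (l / 2 - b)) - ln (cosh b) + l / 2 * tanh b)"
  have "(?F has_real_derivative - 2 * trapezoid_defect (- b) (l / 2 - b) / l ^ 3) (at l)"
    using assms
    by (auto intro!: derivative_eq_intros DERIV_chain2[OF has_real_derivative_ln_cosh]
        simp: trapezoid_defect_def tanh_def[of "l / 2 - b"] tanh_def[of "(l - b * 2) / 2"]
          field_simps power2_eq_square power3_eq_cube)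
  moreover have "eventually (\<lambda>x. bernoulli_h ((1 - tanh b) / 2) x = ?F x) (nhds l)"
    using t1_space_nhds[OF assms] by eventually_elim (simp add: bernoulli_h_conv_ln_cosh)
  ultimately show ?thesis
    by (subst DERIV_cong_ev[OF refl _ refl]) auto
qed

text \<open>
  Subtracting the value at \<open>0\<close> leaves a quotient \<open>N l / l ^ 3\<close> whose numerator vanishes to third
  order; two applications of l'Hopital's rule reduce its limit to a derivative of \<open>tanh\<^sup>2\<close>.
\<close>

lemma bernoulli_h_deriv_zero:
  "(bernoulli_h ((1 - tanh b) / 2) has_real_derivative
    tanh b * (1 - (tanh b)\<^sup>2) / 12) (at 0)"
proof -
  define c where "c = (1 - (tanh b)\<^sup>2) / 4"
  let ?d = "tanh b * (1 - (tanh b)\<^sup>2) / 12"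
  define N where "N = (\<lambda>l. 2 * (ln (cosh (l / 2 - b)) - ln (cosh b) + l / 2 * tanh b) - c * l\<^sup>2)"
  define N1 where "N1 = (\<lambda>l. tanh (l / 2 - b) + tanh b - 2 * c * l)"
  define N2 where "N2 = (\<lambda>l. (1 - (tanh (l / 2 - b))\<^sup>2) / 2 - 2 * c)"
  have dN: "(N has_real_derivative N1 l) (at l)" for l
    unfolding N_def N1_def
    by (auto intro!: derivative_eq_intros DERIV_chain2[OF has_real_derivative_ln_cosh]
        simp: tanh_def[of "l / 2 - b"])
  have dN1: "(N1 has_real_derivative N2 l) (at l)" for l
    unfolding N1_def N2_def
    by (auto intro!: derivative_eq_intros DERIV_chain2[OF has_real_derivative_tanh])
  have dN2: "(N2 has_real_derivative 6 * ?d) (at 0)"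
    unfolding N2_def
    by (auto intro!: derivative_eq_intros DERIV_chain2[OF has_real_derivative_tanh]
        simp: field_simps power2_eq_square)
  have N2_0: "N2 0 = 0" and N1_0: "N1 0 = 0" and N_0: "N 0 = 0"
    by (simp_all add: N_def N1_def N2_def c_def)
  have "((\<lambda>l. N2 l / l) \<longlongrightarrow> 6 * ?d) (at 0)"
    using dN2 by (simp add: has_field_derivative_iff N2_0)
  then have "((\<lambda>l. N2 l / l / 6) \<longlongrightarrow> 6 * ?d / 6) (at 0)"
    by (intro tendsto_intros) auto
  then have t2: "((\<lambda>l. N2 l / (6 * l)) \<longlongrightarrow> ?d) (at 0)" by (simp add: mult.commute)
  have t1: "((\<lambda>l. N1 l / (3 * l\<^sup>2)) \<longlongrightarrow> ?d) (at 0)"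
  proof (rule lhopital[OF _ _ _ _ _ _ t2])
    show "N1 \<midarrow>0\<rightarrow> 0" using DERIV_isCont[OF dN1[of 0]] by (simp add: isCont_def N1_0)
    show "(\<lambda>l::real. 3 * l\<^sup>2) \<midarrow>0\<rightarrow> 0" by (auto intro!: tendsto_eq_intros)
    show "\<forall>\<^sub>F x in at 0. ((\<lambda>l::real. 3 * l\<^sup>2) has_real_derivative 6 * x) (at x)"
      by (auto intro!: derivative_eq_intros always_eventually)
  qed (auto simp: dN1 eventually_at_filter)
  have t0: "((\<lambda>l. N l / l ^ 3) \<longlongrightarrow> ?d) (at 0)"
  proof (rule lhopital[OF _ _ _ _ _ _ t1])
    show "N \<midarrow>0\<rightarrow> 0" using DERIV_isCont[OF dN[of 0]] by (simp add: isCont_def N_0)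
    show "(\<lambda>l::real. l ^ 3) \<midarrow>0\<rightarrow> 0" by (auto intro!: tendsto_eq_intros)
    show "\<forall>\<^sub>F x in at 0. ((\<lambda>l::real. l ^ 3) has_real_derivative 3 * x\<^sup>2) (at x)"
      by (auto intro!: derivative_eq_intros always_eventually)
  qed (auto simp: dN eventually_at_filter)
  have "\<forall>\<^sub>F l in at 0. N l / l ^ 3 =
      (bernoulli_h ((1 - tanh b) / 2) l - bernoulli_h ((1 - tanh b) / 2) 0) / (l - 0)"
    unfolding eventually_at_filter bernoulli_h_conv_ln_cosh N_def c_def
    by (rule always_eventually) (auto simp: field_simps power2_eq_square power3_eq_cube)
  with t0 show ?thesis
    unfolding has_field_derivative_iff by (simp cong: tendsto_cong)
qed

text \<open>
  For \<open>u = l / 2 - b\<close> and \<open>v = - b\<close> the sum \<open>u + v\<close> is \<open>(l - 4 * b) / 2\<close>, so the sign of the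
  trapezoid defect becomes the position of \<open>l\<close> relative to \<open>4 * b\<close>. The value of the derivative at
  \<open>0\<close> follows the same pattern, and so \<open>0\<close> is critical only in the symmetric case \<open>b = 0\<close>.
\<close>

lemma bernoulli_h_deriv_sgn:
  "\<exists>d. (bernoulli_h ((1 - tanh b) / 2) has_real_derivative d) (at l) \<and> sgn d = sgn (4 * b - l)"
proof (cases "l = 0")
  case True
  have "1 - (tanh b)\<^sup>2 > 0"
    using tanh_real_bounds[of b] by (simp add: abs_square_less_1 abs_less_iff)
  then have "sgn (tanh b * (1 - (tanh b)\<^sup>2) / 12) = sgn (4 * b - l)"
    using True by (auto simp: sgn_mult sgn_if divide_simps zero_less_mult_iff)
  then show ?thesis using True bernoulli_h_deriv_zero by blast
next
  case False
  let ?D = "trapezoid_defect (- b) (l / 2 - b)"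
  have "sgn (l / 2 * ?D) = sgn (l / 2 - 2 * b)"
    using sgn_trapezoid_defect[of "l / 2 - b" "- b"] False by simp
  \<comment> \<open>Splitting off \<open>l / 2 = u - v\<close> leaves an even power of \<open>l\<close>, so the other factor is negative on
    both sides of \<open>0\<close>.\<close>
  moreover have "- 2 * ?D / l ^ 3 = - 4 / l ^ 4 * (l / 2 * ?D)"
    using False by (simp add: field_simps eval_nat_numeral)
  moreover have "sgn (- 4 / l ^ 4) = -1" using False by (simp add: sgn_if)
  ultimately have "sgn (- 2 * ?D / l ^ 3) = - sgn (l / 2 - 2 * b)"
    by (metis mult_minus1 sgn_mult)
  also have "\<dots> = sgn (4 * b - l)" by (auto simp: sgn_if)
  finally show ?thesis using bernoulli_h_deriv_nonzero[OF False] by blast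
qed

lemma sgn_deriv_imp_unique_critical_point_and_max:
  fixes f :: "real \<Rightarrow> real"
  assumes "\<And>x. \<exists>d. (f has_real_derivative d) (at x) \<and> sgn d = sgn (c - x)"
  shows "critical_point f x \<longleftrightarrow> x = c" and "x \<noteq> c \<Longrightarrow> f x < f c"
proof -
  show "critical_point f x \<longleftrightarrow> x = c"
    using assms[of x] unfolding critical_point_def
    by (metis DERIV_unique eq_iff_diff_eq_0 sgn_eq_0_iff)
  show "f x < f c" if "x \<noteq> c"
  proof -
    have cont: "continuous_on A f" for A
      using assms by (meson DERIV_isCont continuous_at_imp_continuous_on)
    show ?thesis
    proof (cases "x < c")
      case True
      then show ?thesis
      proof (rule DERIV_pos_imp_increasing_open)
        show "\<exists>d. (f has_real_derivative d) (at y) \<and> 0 < d" if "x < y" "y < c" for y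
          using assms[of y] that by (metis diff_gt_0_iff_gt sgn_greater)
      qed (rule cont)
    next
      case False
      with that have "c < x" by simp
      then show ?thesis
      proof (rule DERIV_neg_imp_decreasing_open)
        show "\<exists>d. (f has_real_derivative d) (at y) \<and> d < 0" if "c < y" "y < x" for y
          using assms[of y] that by (metis diff_less_0_iff_less sgn_less)
      qed (rule cont)
    qed
  qed
qed

section \<open>Sub-Gaussian Bernoulli variables\<close>

lemma bernoulli_rv_integral:
  fixes f :: "real \<Rightarrow> real"
  assumes "bernoulli_rv M X \<mu>" "0 < \<mu>" "\<mu> < 1" and f: "f \<in> borel_measurable borel"
  shows "integrable M (\<lambda>x. f (X x))" and "(LINT x|M. f (X x)) = \<mu> * f 1 + (1 - \<mu>) * f 0"
proof -
  have X: "X \<in> borel_measurable M"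
    and distr: "distr M borel X = distr (measure_pmf (bernoulli_pmf \<mu>)) borel of_bool"
    using assms(1) by (auto simp: bernoulli_rv_def)
  have "integrable (distr M borel X) f"
    unfolding distr using f
    by (subst integrable_distr_eq) (auto intro!: integrable_measure_pmf_finite)
  then show "integrable M (\<lambda>x. f (X x))" using integrable_distr_eq[OF X f] by simp
  have "(LINT x|M. f (X x)) = (LINT x|distr M borel X. f x)"
    using X f by (simp add: integral_distr)
  also have "\<dots> = measure_pmf.expectation (bernoulli_pmf \<mu>) (\<lambda>x. f (of_bool x))"
    unfolding distr using f by (simp add: integral_distr)
  also have "\<dots> = \<mu> * f 1 + (1 - \<mu>) * f 0"
    using assms by simp
  finally show "(LINT x|M. f (X x)) = \<mu> * f 1 + (1 - \<mu>) * f 0" .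
qed

text \<open>
  Taking logarithms in the sub-Gaussian inequality and dividing by \<open>l\<^sup>2 / 2\<close> turns it into a bound
  on \<open>bernoulli_h\<close>. At \<open>l = 0\<close> the inequality is \<open>1 \<le> 1\<close> and gives no information.
\<close>

lemma sub_gaussian_bernoulli_iff:
  assumes X: "bernoulli_rv M X \<mu>" and \<mu>: "0 < \<mu>" "\<mu> < 1"
  shows "sub_gaussian M X w \<longleftrightarrow> 0 < w \<and> (\<forall>l. l \<noteq> 0 \<longrightarrow> bernoulli_h \<mu> l \<le> w)"
proof -
  note int = bernoulli_rv_integral[OF X \<mu>]
  have mean: "(LINT x|M. X x) = \<mu>" and intX: "integrable M X"
    using int[of "\<lambda>x. x"] by simp_all
  have intE: "integrable M (\<lambda>x. exp (l * (X x - \<mu>)))" for l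
    by (rule int(1)[of "\<lambda>x. exp (l * (x - \<mu>))"]) measurable
  have pos: "0 < \<mu> * exp l + 1 - \<mu>" for l
    using \<mu> by (smt (verit) exp_gt_zero mult_pos_pos)
  have mgf: "(LINT x|M. exp (l * (X x - \<mu>))) = exp (ln (\<mu> * exp l + 1 - \<mu>) - \<mu> * l)" for l
  proof -
    have "(LINT x|M. exp (l * (X x - \<mu>))) = \<mu> * exp (l * (1 - \<mu>)) + (1 - \<mu>) * exp (l * (0 - \<mu>))"
      by (rule int(2)[of "\<lambda>x. exp (l * (x - \<mu>))"]) measurable
    also have "\<dots> = (\<mu> * exp l + 1 - \<mu>) * exp (- \<mu> * l)"
      by (simp add: algebra_simps exp_diff exp_minus divide_inverse)
    also have "\<dots> = exp (ln (\<mu> * exp l + 1 - \<mu>) - \<mu> * l)"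
      using pos by (simp add: exp_diff exp_minus divide_inverse)
    finally show ?thesis .
  qed
  have "(LINT x|M. exp (l * (X x - \<mu>))) \<le> exp (l\<^sup>2 * w / 2)
      \<longleftrightarrow> (l \<noteq> 0 \<longrightarrow> bernoulli_h \<mu> l \<le> w)" for l
    unfolding mgf by (cases "l = 0") (simp_all add: bernoulli_h_def field_simps)
  then show ?thesis
    using intX intE by (simp add: sub_gaussian_def mean)
qed

lemma tendsto_logit_ratio_half:
  "((\<lambda>p::real. (1/2 - p) / ln (1 / p - 1)) \<longlongrightarrow> 1/4) (at (1/2))"
proof (rule lhopital)
  show "(\<lambda>p::real. 1/2 - p) \<midarrow>1/2\<rightarrow> 0" by (auto intro!: tendsto_eq_intros)
  show "(\<lambda>p::real. ln (1 / p - 1)) \<midarrow>1/2\<rightarrow> 0" by (auto intro!: tendsto_eq_intros)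
  have ev: "\<forall>\<^sub>F p in at (1/2). p \<in> {0<..<1::real}"
    by (rule eventually_at_in_open') auto
  have ne: "\<forall>\<^sub>F p in at (1/2). p \<noteq> (1/2::real)" by (rule eventually_neq_at_within)
  show "\<forall>\<^sub>F p::real in at (1/2). ln (1 / p - 1) \<noteq> 0"
    using ev ne by eventually_elim (auto simp: field_simps)
  show "\<forall>\<^sub>F p::real in at (1/2). ((\<lambda>p. 1/2 - p) has_real_derivative -1) (at p)"
    by (auto intro!: derivative_eq_intros always_eventually)
  show "\<forall>\<^sub>F p::real in at (1/2). ((\<lambda>p. ln (1 / p - 1)) has_real_derivative
      - 1 / (p * (1 - p))) (at p)"
    using ev
  proof eventually_elim
    case (elim p)
    then have "0 < 1 / p - 1" by (simp add: field_simps)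
    moreover have "((\<lambda>p. 1 / p - 1) has_real_derivative - 1 / p\<^sup>2) (at p)"
      using elim by (auto intro!: derivative_eq_intros simp: power2_eq_square)
    ultimately have "((\<lambda>p. ln (1 / p - 1)) has_real_derivative
        inverse (1 / p - 1) * (- 1 / p\<^sup>2)) (at p)"
      by (intro DERIV_chain2[OF DERIV_ln])
    also have "inverse (1 / p - 1) * (- 1 / p\<^sup>2) = - 1 / (p * (1 - p))"
      using elim by (simp add: divide_simps power2_eq_square)
    finally show ?case .
  qed
  show "\<forall>\<^sub>F p::real in at (1/2). - 1 / (p * (1 - p)) \<noteq> 0"
    using ev by eventually_elim auto
  show "(\<lambda>p::real. -1 / (- 1 / (p * (1 - p)))) \<midarrow>1/2\<rightarrow> 1/4"
    by (auto intro!: tendsto_eq_intros)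
qed

theorem proposition4p1:
  fixes M :: "'a measure" and X :: "'a \<Rightarrow> real" and \<mu> l0 :: real
  assumes "prob_space M" and "0 < \<mu>" and "\<mu> < 1" and "bernoulli_rv M X \<mu>"
  defines "l0 \<equiv> 2 * ln ((1 - \<mu>) / \<mu>)"
  shows "(\<exists>!l. critical_point (bernoulli_h \<mu>) l) \<and>
    (\<forall>l. critical_point (bernoulli_h \<mu>) l \<longrightarrow> (\<forall>x. bernoulli_h \<mu> x \<le> bernoulli_h \<mu> l)) \<and>
    (\<forall>l. (\<forall>x. bernoulli_h \<mu> x \<le> bernoulli_h \<mu> l) \<longleftrightarrow> l = l0) \<and>
    is_optimal_proxy_variance M X (bernoulli_h \<mu> l0) \<and>
    bernoulli_h \<mu> l0 = (if \<mu> = 1/2 then 1/4 else (1/2 - \<mu>) / ln (1 / \<mu> - 1)) \<and>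
    ((\<lambda>p::real. (1/2 - p) / ln (1 / p - 1)) \<longlongrightarrow> 1/4) (at (1/2))"
proof -
  note \<mu> = assms(2,3) and X = assms(4)
  define b where "b = ln ((1 - \<mu>) / \<mu>) / 2"
  have l0: "l0 = 4 * b" by (simp add: l0_def b_def)
  have "exp (2 * b) = (1 - \<mu>) / \<mu>" using \<mu> by (simp add: b_def)
  then have "exp (- 2 * b) = \<mu> / (1 - \<mu>)" by (simp add: exp_minus)
  then have "tanh b = 1 - 2 * \<mu>"
    unfolding tanh_real_altdef using \<mu> by (simp only:) (simp add: field_simps)
  then have \<mu>b: "\<mu> = (1 - tanh b) / 2" by simp
  have slope: "\<exists>d. (bernoulli_h \<mu> has_real_derivative d) (at l) \<and> sgn d = sgn (l0 - l)" for l
    unfolding \<mu>b l0 by (rule bernoulli_h_deriv_sgn)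
  note crit = sgn_deriv_imp_unique_critical_point_and_max(1)[OF slope]
    and max = sgn_deriv_imp_unique_critical_point_and_max(2)[OF slope]
  have le: "bernoulli_h \<mu> x \<le> bernoulli_h \<mu> l0" for x
    using max[of x] by (cases "x = l0") auto
  have "0 < bernoulli_h \<mu> 0" using \<mu> by (simp add: bernoulli_h_def)
  also have "\<dots> \<le> bernoulli_h \<mu> l0" by (rule le)
  finally have pos: "0 < bernoulli_h \<mu> l0" .
  have opt: "is_optimal_proxy_variance M X (bernoulli_h \<mu> l0)"
    unfolding is_optimal_proxy_variance_def sub_gaussian_bernoulli_iff[OF X \<mu>]
  proof (intro conjI allI impI pos le)
    fix w assume w: "0 < w \<and> (\<forall>l. l \<noteq> 0 \<longrightarrow> bernoulli_h \<mu> l \<le> w)"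
    \<comment> \<open>For \<open>\<mu> = 1/2\<close> the maximizer is \<open>0\<close>, where sub-Gaussianity bounds \<open>bernoulli_h\<close> only on
      the punctured neighbourhood; continuity closes the gap.\<close>
    have "bernoulli_h \<mu> \<midarrow>l0\<rightarrow> bernoulli_h \<mu> l0"
      using slope DERIV_isCont isCont_def by blast
    moreover have "\<forall>\<^sub>F l in at l0. bernoulli_h \<mu> l \<le> w"
      using eventually_neq_at_within[of 0 l0 UNIV] by eventually_elim (use w in auto)
    ultimately show "bernoulli_h \<mu> l0 \<le> w"
      by (intro tendsto_upperbound) auto
  qed
  have "bernoulli_h \<mu> l0 = (if \<mu> = 1/2 then 1/4 else (1/2 - \<mu>) / ln (1 / \<mu> - 1))"
  proof (cases "\<mu> = 1/2")
    case True
    show ?thesis unfolding l0_def bernoulli_h_def True by simp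
  next
    case False
    then have "b \<noteq> 0" using \<mu>b by auto
    then have "bernoulli_h \<mu> l0 = tanh b / (4 * b)"
      unfolding \<mu>b l0 bernoulli_h_conv_ln_cosh by (simp add: field_simps power2_eq_square)
    also have "\<dots> = (1/2 - \<mu>) / (2 * b)" using \<open>b \<noteq> 0\<close> by (subst \<mu>b) (simp add: field_simps)
    also have "2 * b = ln (1 / \<mu> - 1)" using \<mu> by (simp add: b_def diff_divide_distrib)
    finally show ?thesis using False by simp
  qed
  moreover have "(\<forall>x. bernoulli_h \<mu> x \<le> bernoulli_h \<mu> l) \<longleftrightarrow> l = l0" for l
    using max[of l] le by (metis not_less)
  ultimately show ?thesis
    using crit le opt tendsto_logit_ratio_half by auto
qed

end
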